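(* Let $m,n$ be positive integers, $\mathfrak{g}=\mathfrak{gl}_{m\vert n}$ over $\mathbb{K}$, and let $B\in\mathfrak{g}_1$ be the element of rank $r$ in normal form, i.e. whose upper-right $m\times n$ block is $\begin{pmatrix} I_r & 0\\ 0&0\end{pmatrix}$. Identify elements of $\mathfrak{g}_{-1}$ with their lower-left $n\times m$ blocks, partitioned with row sizes $(r,n-r)$ and column sizes $(r,m-r)$. Let $$R=\left\{\begin{pmatrix}\alpha I_r & X_{12}\\ X_{21}&X_{22}\end{pmatrix} : \alpha\in\mathbb{K}\right\}$$ (with $X_{12},X_{21},X_{22}$ arbitrary matrices over $\mathbb{K}$ of the appropriate sizes) and $$S=\left\{\begin{pmatrix}X_{11}&0\\0&0\end{pmatrix} : X_{11}\in M_r(\mathbb{K}),\ \operatorname{tr}(X_{11})=0\right\}.$$ Then, with respect to the Lie bracket of $\mathfrak{g}^B_{-1}$: (a) $R$ is solvable; (b) $S$ is semisimple; (c) $R$ is the radical of $\mathfrak{g}^B_{-1}$ and $S$ is a Levi subalgebra of $\mathfrak{g}^B_{-1}$, and $\mathfrak{g}^B_{-1}=S\oplus R$ is a Levi-Malcev decomposition.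
   Context: $\mathbb{K}$ is a field of characteristic zero. $\mathfrak{gl}_{m\vert n}$ is the Lie superalgebra of $(m+n)\times(m+n)$ matrices $\begin{pmatrix} A & B\\ C& D\end{pmatrix}$ over $\mathbb{K}$ ($A$ of size $m\times m$, $B$ of size $m\times n$, $C$ of size $n\times m$, $D$ of size $n\times n$), with even part the block diagonal matrices, odd part the block off-diagonal matrices, and superbracket $[X,Y]=XY-(-1)^{(\deg X)(\deg Y)}YX$ for homogeneous $X,Y$. It is $\mathbb{Z}$-graded, $\mathfrak{g}=\mathfrak{g}_{-1}\oplus\mathfrak{g}_0\oplus\mathfrak{g}_1$, where $\mathfrak{g}_0$ consists of the block diagonal matrices, $\mathfrak{g}_{1}$ of the matrices $\begin{pmatrix}0&\mathbf{b}\\0&0\end{pmatrix}$ and $\mathfrak{g}_{-1}$ of the matrices $\begin{pmatrix}0&0\\ \mathbf{c}&0\end{pmatrix}$. For $B\in\mathfrak{g}_1$, $\mathfrak{g}^B_{-1}$ denotes the vector space $\mathfrak{g}_{-1}$ with the derived bracket $\llbracket X,Y\rrbracket_B=[X,[B,Y]]$, $X,Y\in\mathfrak{g}_{-1}$; this is a Lie algebra over $\mathbb{K}$. The radical of a finite-dimensional Lie algebra $L$ is its maximal solvable ideal; $L$ is semisimple if its radical is zero (in particular the zero Lie algebra counts as semisimple, which is what $S$ is when $r\le 1$). A Levi subalgebra of $L$ is a semisimple subalgebra $\mathfrak{s}$ such that $L=\mathfrak{s}\oplus\mathfrak{r}$ as vector spaces (a semidirect sum), where $\mathfrak{r}$ is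 the radical; this is called a Levi-Malcev decomposition. *)

theory Defs
  imports "Jordan_Normal_Form.VS_Connect"
begin

section \<open>Lie algebras over a field\<close>

text \<open>As for modules in HOL-Algebra, the fields \<open>mult\<close> and \<open>one\<close> inherited from the ring record
  play no role.\<close>

record ('a, 'b) lie_alg = "('a, 'b) module" +
  lie_bracket :: "'b \<Rightarrow> 'b \<Rightarrow> 'b"

locale lie_algebra = vectorspace K L
  for K :: "('a, 'e) ring_scheme" and L :: "('a, 'b, 'c) lie_alg_scheme" +
  assumes bracket_closed:
      "\<lbrakk>x \<in> carrier L; y \<in> carrier L\<rbrakk> \<Longrightarrow> lie_bracket L x y \<in> carrier L"
    and bracket_add_left:
      "\<lbrakk>x \<in> carrier L; y \<in> carrier L; z \<in> carrier L\<rbrakk> \<Longrightarrow>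
        lie_bracket L (x \<oplus>\<^bsub>L\<^esub> y) z = lie_bracket L x z \<oplus>\<^bsub>L\<^esub> lie_bracket L y z"
    and bracket_add_right:
      "\<lbrakk>x \<in> carrier L; y \<in> carrier L; z \<in> carrier L\<rbrakk> \<Longrightarrow>
        lie_bracket L x (y \<oplus>\<^bsub>L\<^esub> z) = lie_bracket L x y \<oplus>\<^bsub>L\<^esub> lie_bracket L x z"
    and bracket_smult_left:
      "\<lbrakk>a \<in> carrier K; x \<in> carrier L; y \<in> carrier L\<rbrakk> \<Longrightarrow>
        lie_bracket L (a \<odot>\<^bsub>L\<^esub> x) y = a \<odot>\<^bsub>L\<^esub> lie_bracket L x y"
    and bracket_smult_right:
      "\<lbrakk>a \<in> carrier K; x \<in> carrier L; y \<in> carrier L\<rbrakk> \<Longrightarrow>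
        lie_bracket L x (a \<odot>\<^bsub>L\<^esub> y) = a \<odot>\<^bsub>L\<^esub> lie_bracket L x y"
    and bracket_self: "x \<in> carrier L \<Longrightarrow> lie_bracket L x x = \<zero>\<^bsub>L\<^esub>"
    and jacobi:
      "\<lbrakk>x \<in> carrier L; y \<in> carrier L; z \<in> carrier L\<rbrakk> \<Longrightarrow>
        lie_bracket L x (lie_bracket L y z) \<oplus>\<^bsub>L\<^esub> lie_bracket L y (lie_bracket L z x)
          \<oplus>\<^bsub>L\<^esub> lie_bracket L z (lie_bracket L x y) = \<zero>\<^bsub>L\<^esub>"

definition lie_subalgebra ::
    "('a, 'e) ring_scheme \<Rightarrow> ('a, 'b, 'c) lie_alg_scheme \<Rightarrow> 'b set \<Rightarrow> bool" where
  "lie_subalgebra K L H \<longleftrightarrow>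
     submodule K H L \<and> (\<forall>x\<in>H. \<forall>y\<in>H. lie_bracket L x y \<in> H)"

definition lie_ideal ::
    "('a, 'e) ring_scheme \<Rightarrow> ('a, 'b, 'c) lie_alg_scheme \<Rightarrow> 'b set \<Rightarrow> bool" where
  "lie_ideal K L I \<longleftrightarrow>
     submodule K I L \<and> (\<forall>x\<in>carrier L. \<forall>y\<in>I. lie_bracket L x y \<in> I)"

fun derived_series ::
    "('a, 'e) ring_scheme \<Rightarrow> ('a, 'b, 'c) lie_alg_scheme \<Rightarrow> nat \<Rightarrow> 'b set" where
  "derived_series K L 0 = carrier L"
| "derived_series K L (Suc k) =
     LinearCombinations.module.span K L {lie_bracket L x y | x y. x \<in> derived_series K L k \<and> y \<in> derived_series K L k}"

text \<open>A subalgebra \<open>H\<close> of \<open>L\<close>, as a Lie algebra in its own right, is \<open>L\<lparr>carrier := H\<rparr>\<close>.\<close>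

definition lie_solvable ::
    "('a, 'e) ring_scheme \<Rightarrow> ('a, 'b, 'c) lie_alg_scheme \<Rightarrow> bool" where
  "lie_solvable K L \<longleftrightarrow> (\<exists>k. derived_series K L k = {\<zero>\<^bsub>L\<^esub>})"

text \<open>``The'' maximal solvable ideal is read as the largest one, i.e. the one that contains every
  solvable ideal; in finite dimension this is the same as maximality under inclusion.\<close>

definition is_lie_radical ::
    "('a, 'e) ring_scheme \<Rightarrow> ('a, 'b, 'c) lie_alg_scheme \<Rightarrow> 'b set \<Rightarrow> bool" where
  "is_lie_radical K L R \<longleftrightarrow>
     lie_ideal K L R \<and> lie_solvable K (L\<lparr>carrier := R\<rparr>) \<and>
     (\<forall>I. lie_ideal K L I \<and> lie_solvable K (L\<lparr>carrier := I\<rparr>) \<longrightarrow> I \<subseteq> R)"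

definition lie_semisimple ::
    "('a, 'e) ring_scheme \<Rightarrow> ('a, 'b, 'c) lie_alg_scheme \<Rightarrow> bool" where
  "lie_semisimple K L \<longleftrightarrow> is_lie_radical K L {\<zero>\<^bsub>L\<^esub>}"

definition internal_direct_sum ::
    "('a, 'b, 'c) module_scheme \<Rightarrow> 'b set \<Rightarrow> 'b set \<Rightarrow> bool" where
  "internal_direct_sum V U W \<longleftrightarrow>
     carrier V = {u \<oplus>\<^bsub>V\<^esub> w | u w. u \<in> U \<and> w \<in> W} \<and> U \<inter> W = {\<zero>\<^bsub>V\<^esub>}"

definition levi_subalgebra ::
    "('a, 'e) ring_scheme \<Rightarrow> ('a, 'b, 'c) lie_alg_scheme \<Rightarrow> 'b set \<Rightarrow> bool" where
  "levi_subalgebra K L S \<longleftrightarrow>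
     lie_subalgebra K L S \<and> lie_semisimple K (L\<lparr>carrier := S\<rparr>) \<and>
     (\<exists>R. is_lie_radical K L R \<and> internal_direct_sum L S R)"

definition levi_malcev_decomposition ::
    "('a, 'e) ring_scheme \<Rightarrow> ('a, 'b, 'c) lie_alg_scheme \<Rightarrow> 'b set \<Rightarrow> 'b set \<Rightarrow> bool" where
  "levi_malcev_decomposition K L S R \<longleftrightarrow>
     levi_subalgebra K L S \<and> is_lie_radical K L R \<and> internal_direct_sum L S R"


section \<open>The Lie superalgebra of type $(m|n)$ and derived brackets\<close>

text \<open>The homogeneous component of a matrix of parity \<open>d\<close> (mod 2): the block diagonal part for
  even \<open>d\<close>, the block off-diagonal part for odd \<open>d\<close>.\<close>

definition parity_part :: "nat \<Rightarrow> nat \<Rightarrow> nat \<Rightarrow> 'a::zero mat \<Rightarrow> 'a mat" where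
  "parity_part m n d X =
     mat (m + n) (m + n) (\<lambda>(i, j). if ((i < m) = (j < m)) = even d then X $$ (i, j) else 0)"

definition homogeneous_bracket :: "nat \<Rightarrow> nat \<Rightarrow> 'a::comm_ring_1 mat \<Rightarrow> 'a mat \<Rightarrow> 'a mat" where
  "homogeneous_bracket d e X Y = X * Y - (- 1) ^ (d * e) \<cdot>\<^sub>m (Y * X)"

definition superbracket :: "nat \<Rightarrow> nat \<Rightarrow> 'a::comm_ring_1 mat \<Rightarrow> 'a mat \<Rightarrow> 'a mat" where
  "superbracket m n X Y =
     homogeneous_bracket 0 0 (parity_part m n 0 X) (parity_part m n 0 Y) +
     homogeneous_bracket 0 1 (parity_part m n 0 X) (parity_part m n 1 Y) +
     homogeneous_bracket 1 0 (parity_part m n 1 X) (parity_part m n 0 Y) +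
     homogeneous_bracket 1 1 (parity_part m n 1 X) (parity_part m n 1 Y)"

definition upper_right :: "nat \<Rightarrow> nat \<Rightarrow> 'a::zero mat \<Rightarrow> 'a mat" where
  "upper_right m n b = four_block_mat (0\<^sub>m m m) b (0\<^sub>m n m) (0\<^sub>m n n)"

definition lower_left :: "nat \<Rightarrow> nat \<Rightarrow> 'a::zero mat \<Rightarrow> 'a mat" where
  "lower_left m n c = four_block_mat (0\<^sub>m m m) (0\<^sub>m m n) c (0\<^sub>m n n)"

definition gl_plus :: "nat \<Rightarrow> nat \<Rightarrow> 'a::zero mat set" where
  "gl_plus m n = upper_right m n ` carrier_mat m n"

definition gl_minus :: "nat \<Rightarrow> nat \<Rightarrow> 'a::zero mat set" where
  "gl_minus m n = lower_left m n ` carrier_mat n m"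

definition derived_bracket ::
    "nat \<Rightarrow> nat \<Rightarrow> 'a::comm_ring_1 mat \<Rightarrow> 'a mat \<Rightarrow> 'a mat \<Rightarrow> 'a mat" where
  "derived_bracket m n B X Y = superbracket m n X (superbracket m n B Y)"

definition gl_minus_derived ::
    "nat \<Rightarrow> nat \<Rightarrow> 'a::comm_ring_1 mat \<Rightarrow> ('a, 'a mat) lie_alg" where
  "gl_minus_derived m n B =
     \<lparr>carrier = gl_minus m n, mult = (*), one = 1\<^sub>m (m + n), zero = 0\<^sub>m (m + n) (m + n),
      add = (+), smult = (\<cdot>\<^sub>m), lie_bracket = derived_bracket m n B\<rparr>"

definition normal_form :: "nat \<Rightarrow> nat \<Rightarrow> nat \<Rightarrow> 'a::zero_neq_one mat" where
  "normal_form m n r =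
     upper_right m n
       (four_block_mat (1\<^sub>m r) (0\<^sub>m r (n - r)) (0\<^sub>m (m - r) r) (0\<^sub>m (m - r) (n - r)))"

definition mat_trace :: "'a::comm_monoid_add mat \<Rightarrow> 'a" where
  "mat_trace A = (\<Sum>i<dim_row A. A $$ (i, i))"

definition radical_part :: "nat \<Rightarrow> nat \<Rightarrow> nat \<Rightarrow> 'a::comm_ring_1 mat set" where
  "radical_part m n r =
     {lower_left m n (four_block_mat (\<alpha> \<cdot>\<^sub>m 1\<^sub>m r) X12 X21 X22) | \<alpha> X12 X21 X22.
        X12 \<in> carrier_mat r (m - r) \<and> X21 \<in> carrier_mat (n - r) r \<and>
        X22 \<in> carrier_mat (n - r) (m - r)}"

definition levi_part :: "nat \<Rightarrow> nat \<Rightarrow> nat \<Rightarrow> 'a::comm_ring_1 mat set" where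
  "levi_part m n r =
     {lower_left m n
        (four_block_mat X11 (0\<^sub>m r (m - r)) (0\<^sub>m (n - r) r) (0\<^sub>m (n - r) (m - r))) | X11.
        X11 \<in> carrier_mat r r \<and> mat_trace X11 = 0}"


section \<open>The derived bracket is a Lie bracket\<close>

lemma normal_form_in_gl_plus:
  assumes "r \<le> m" "r \<le> n"
  shows "normal_form m n r \<in> gl_plus m n"
proof -
  have "four_block_mat (1\<^sub>m r) (0\<^sub>m r (n - r)) (0\<^sub>m (m - r) r) (0\<^sub>m (m - r) (n - r))
      \<in> carrier_mat (r + (m - r)) (r + (n - r))"
    by (rule four_block_carrier_mat) auto
  then show ?thesis
    using assms unfolding normal_form_def gl_plus_def by auto
qed

lemma upper_right_carrier: "b \<in> carrier_mat m n \<Longrightarrow> upper_right m n b \<in> carrier_mat (m + n) (m + n)"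
  unfolding upper_right_def by auto

lemma lower_left_carrier: "c \<in> carrier_mat n m \<Longrightarrow> lower_left m n c \<in> carrier_mat (m + n) (m + n)"
  unfolding lower_left_def by auto

lemma parity_part_upper_right:
  assumes "b \<in> carrier_mat m n"
  shows "parity_part m n 0 (upper_right m n b) = 0\<^sub>m (m + n) (m + n)"
    and "parity_part m n 1 (upper_right m n b) = upper_right m n b"
  using assms by (auto simp: parity_part_def upper_right_def intro!: eq_matI)

lemma parity_part_lower_left:
  assumes "c \<in> carrier_mat n m"
  shows "parity_part m n 0 (lower_left m n c) = 0\<^sub>m (m + n) (m + n)"
    and "parity_part m n 1 (lower_left m n c) = lower_left m n c"
  using assms by (auto simp: parity_part_def lower_left_def intro!: eq_matI)

lemma parity_part_block_diag:
  assumes "a \<in> carrier_mat m m" "d \<in> carrier_mat n n"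
  shows "parity_part m n 0 (four_block_mat a (0\<^sub>m m n) (0\<^sub>m n m) d)
      = four_block_mat a (0\<^sub>m m n) (0\<^sub>m n m) d"
    and "parity_part m n 1 (four_block_mat a (0\<^sub>m m n) (0\<^sub>m n m) d) = 0\<^sub>m (m + n) (m + n)"
  using assms by (auto simp: parity_part_def intro!: eq_matI)

lemma homogeneous_bracket_zero:
  fixes X :: "'a::comm_ring_1 mat"
  assumes "X \<in> carrier_mat k k"
  shows "homogeneous_bracket d e (0\<^sub>m k k) X = 0\<^sub>m k k"
    and "homogeneous_bracket d e X (0\<^sub>m k k) = 0\<^sub>m k k"
  using assms by (auto simp: homogeneous_bracket_def)

lemma superbracket_upper_lower:
  fixes b :: "'a::comm_ring_1 mat"
  assumes b: "b \<in> carrier_mat m n" and y: "y \<in> carrier_mat n m"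
  shows "superbracket m n (upper_right m n b) (lower_left m n y)
      = four_block_mat (b * y) (0\<^sub>m m n) (0\<^sub>m n m) (y * b)"
proof -
  let ?U = "upper_right m n b" and ?Y = "lower_left m n y"
  have bY: "b * y \<in> carrier_mat m m" and yB: "y * b \<in> carrier_mat n n" using b y by auto
  have UY: "?U * ?Y = four_block_mat (b * y) (0\<^sub>m m n) (0\<^sub>m n m) (0\<^sub>m n n)"
    unfolding upper_right_def lower_left_def
    by (subst mult_four_block_mat[of _ m m _ n _ n _ _ m _ n]) (use b y bY yB in auto)
  have YU: "?Y * ?U = four_block_mat (0\<^sub>m m m) (0\<^sub>m m n) (0\<^sub>m n m) (y * b)"
    unfolding upper_right_def lower_left_def
    by (subst mult_four_block_mat[of _ m m _ n _ n _ _ m _ n]) (use b y bY yB in auto)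
  have "superbracket m n ?U ?Y = ?U * ?Y + ?Y * ?U"
    unfolding superbracket_def parity_part_upper_right[OF b] parity_part_lower_left[OF y]
      homogeneous_bracket_zero[OF upper_right_carrier[OF b]]
      homogeneous_bracket_zero[OF lower_left_carrier[OF y]]
      homogeneous_bracket_zero[OF zero_carrier_mat]
    unfolding homogeneous_bracket_def
    using upper_right_carrier[OF b] lower_left_carrier[OF y]
    by (intro eq_matI) (auto simp del: index_mult_mat(1))
  also have "\<dots> = four_block_mat (b * y) (0\<^sub>m m n) (0\<^sub>m n m) (y * b)"
    unfolding UY YU using bY yB
    by (subst add_four_block_mat[of _ m m _ n _ n]) auto
  finally show ?thesis .
qed

lemma derived_bracket_eq:
  fixes b :: "'a::comm_ring_1 mat"
  assumes b: "b \<in> carrier_mat m n" and x: "x \<in> carrier_mat n m" and y: "y \<in> carrier_mat n m"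
  shows "derived_bracket m n (upper_right m n b) (lower_left m n x) (lower_left m n y)
      = lower_left m n (x * b * y - y * b * x)"
proof -
  let ?X = "lower_left m n x" and ?D = "four_block_mat (b * y) (0\<^sub>m m n) (0\<^sub>m n m) (y * b)"
  have bY: "b * y \<in> carrier_mat m m" and yB: "y * b \<in> carrier_mat n n" using b y by auto
  have D: "?D \<in> carrier_mat (m + n) (m + n)" using bY yB by auto
  have XD: "?X * ?D = lower_left m n (x * b * y)"
    unfolding lower_left_def
    by (subst mult_four_block_mat[of _ m m _ n _ n _ _ m _ n]) (use b x y bY yB in auto)
  have DX: "?D * ?X = lower_left m n (y * b * x)"
    unfolding lower_left_def
    by (subst mult_four_block_mat[of _ m m _ n _ n _ _ m _ n]) (use b x y bY yB in auto)
  have "superbracket m n ?X ?D = ?X * ?D - ?D * ?X"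
    unfolding superbracket_def parity_part_lower_left[OF x] parity_part_block_diag[OF bY yB]
      homogeneous_bracket_zero[OF lower_left_carrier[OF x]]
      homogeneous_bracket_zero[OF D] homogeneous_bracket_zero[OF zero_carrier_mat]
    unfolding homogeneous_bracket_def
    using lower_left_carrier[OF x] D
    by (intro eq_matI) (auto simp del: index_mult_mat(1))
  also have "\<dots> = lower_left m n (x * b * y - y * b * x)"
    unfolding XD DX unfolding lower_left_def using b x y by (auto intro!: eq_matI)
  finally show ?thesis
    unfolding derived_bracket_def superbracket_upper_lower[OF b y] .
qed

lemma lower_left_add:
  assumes "x \<in> carrier_mat n m" "y \<in> carrier_mat n m"
  shows "lower_left m n x + lower_left m n y = lower_left m n (x + (y :: 'a::comm_ring_1 mat))"
  using assms unfolding lower_left_def by (auto intro!: eq_matI)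

lemma lower_left_smult:
  assumes "x \<in> carrier_mat n m"
  shows "a \<cdot>\<^sub>m lower_left m n x = lower_left m n (a \<cdot>\<^sub>m (x :: 'a::comm_ring_1 mat))"
  using assms unfolding lower_left_def by (auto intro!: eq_matI)

lemma lower_left_zero: "0\<^sub>m (m + n) (m + n) = lower_left m n (0\<^sub>m n m)"
  unfolding lower_left_def by simp

theorem lie_algebra_gl_minus_derived:
  fixes B :: "'k::field mat"
  assumes "B \<in> gl_plus m n"
  shows "lie_algebra (class_ring :: 'k ring) (gl_minus_derived m n B)"
proof -
  obtain b where b: "b \<in> carrier_mat m n" and B: "B = upper_right m n b"
    using assms unfolding gl_plus_def by auto
  let ?L = "gl_minus_derived m n B"
  note br = derived_bracket_eq[OF b]
  have dist: "(x + y) * b * z = x * b * z + y * b * z" "z * b * (x + y) = z * b * x + z * b * y"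
      "(x - y) * b * z = x * b * z - y * b * z" "z * b * (x - y) = z * b * x - z * b * y"
      "(a \<cdot>\<^sub>m x) * b * y = a \<cdot>\<^sub>m (x * b * y)" "y * b * (a \<cdot>\<^sub>m x) = a \<cdot>\<^sub>m (y * b * x)"
      "x * b * (y * b * z) = x * b * y * b * z"
    if "x \<in> carrier_mat n m" "y \<in> carrier_mat n m" "z \<in> carrier_mat n m" for x y z a
    using that b
    by (simp_all add: add_mult_distrib_mat[of _ n m _ _ n] add_mult_distrib_mat[of _ n n _ _ m]
        mult_add_distrib_mat[of _ n n _ m]
        minus_mult_distrib_mat[of _ n m _ _ n] minus_mult_distrib_mat[of _ n n _ _ m]
        mult_minus_distrib_mat[of _ n n _ m] mult_smult_distrib[of _ n n _ m]
        mult_smult_assoc_mat[of _ n m _ n] mult_smult_assoc_mat[of _ n n _ m]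
        assoc_mult_mat[of _ n n _ m _ m] assoc_mult_mat[of _ n n _ n _ m]
        assoc_mult_mat[of _ n m _ n _ m] assoc_mult_mat[of _ n m _ n _ n]
        assoc_mult_mat[of _ n m _ m _ m] assoc_mult_mat[of _ m n _ m _ m])
  have ab: "abelian_group ?L"
  proof (rule abelian_groupI)
    fix X assume "X \<in> carrier ?L"
    then obtain x where x: "x \<in> carrier_mat n m" "X = lower_left m n x"
      unfolding gl_minus_derived_def gl_minus_def by auto
    have "lower_left m n (- x) + lower_left m n x = lower_left m n (0\<^sub>m n m)"
      using x by (subst lower_left_add) auto
    then show "\<exists>Y\<in>carrier ?L. Y \<oplus>\<^bsub>?L\<^esub> X = \<zero>\<^bsub>?L\<^esub>"
      using x unfolding gl_minus_derived_def gl_minus_def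
      by (auto simp: lower_left_zero intro!: bexI[of _ "- x"])
  qed (auto simp: gl_minus_derived_def gl_minus_def lower_left_add lower_left_zero comm_add_mat
        intro!: arg_cong[of _ _ "lower_left m n"] imageI)
  have sm1: "(a * c) \<cdot>\<^sub>m x = a \<cdot>\<^sub>m (c \<cdot>\<^sub>m x)" "1 \<cdot>\<^sub>m x = x" for a c :: 'k and x
    by (auto simp: mult.assoc)
  have md: "module class_ring ?L"
    by (intro moduleI class_cring.is_cring ab)
      (auto simp: gl_minus_derived_def gl_minus_def lower_left_add lower_left_smult sm1
        add_smult_distrib_left_mat[of _ n m] add_smult_distrib_right_mat[of _ n m]
        intro!: arg_cong[of _ _ "lower_left m n"] imageI)
  have car: "carrier ?L = lower_left m n ` carrier_mat n m"
    and add: "add ?L = (+)" and sm: "smult ?L = (\<cdot>\<^sub>m)"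
    and ze: "zero ?L = lower_left m n (0\<^sub>m n m)"
    and lb: "lie_bracket ?L = derived_bracket m n (upper_right m n b)"
    by (simp_all add: gl_minus_derived_def gl_minus_def B lower_left_zero)
  have cl: "x * b * y \<in> carrier_mat n m" if "x \<in> carrier_mat n m" "y \<in> carrier_mat n m" for x y
    using that b by auto
  show ?thesis
  proof (intro lie_algebra.intro vectorspace.intro lie_algebra_axioms.intro md class_field,
      unfold car add sm ze lb, goal_cases)
    case (1 X Y)
    then show ?case using cl by (auto simp: br intro!: imageI minus_carrier_mat simp del: assoc_mult_mat)
  next
    case (2 X Y Z)
    then show ?case using cl
      by (elim imageE, simp add: br lower_left_add dist minus_carrier_mat del: assoc_mult_mat,
          intro arg_cong[of _ _ "lower_left m n"] eq_matI)
        (auto simp del: index_mult_mat(1) assoc_mult_mat)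
  next
    case (3 X Y Z)
    then show ?case using cl
      by (elim imageE, simp add: br lower_left_add dist minus_carrier_mat del: assoc_mult_mat,
          intro arg_cong[of _ _ "lower_left m n"] eq_matI)
        (auto simp del: index_mult_mat(1) assoc_mult_mat)
  next
    case (4 a X Y)
    then show ?case using cl
      by (elim imageE, simp add: br lower_left_smult dist minus_carrier_mat del: assoc_mult_mat,
          intro arg_cong[of _ _ "lower_left m n"] eq_matI)
        (auto simp: right_diff_distrib simp del: index_mult_mat(1) assoc_mult_mat)
  next
    case (5 a X Y)
    then show ?case using cl
      by (elim imageE, simp add: br lower_left_smult dist minus_carrier_mat del: assoc_mult_mat,
          intro arg_cong[of _ _ "lower_left m n"] eq_matI)
        (auto simp: right_diff_distrib simp del: index_mult_mat(1) assoc_mult_mat)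
  next
    case (6 X)
    then show ?case using cl
      by (auto simp: br minus_r_inv_mat[of _ n m] simp del: assoc_mult_mat)
  next
    case (7 X Y Z)
    then show ?case using cl
      by (elim imageE, simp add: br lower_left_add dist minus_carrier_mat del: assoc_mult_mat,
          intro arg_cong[of _ _ "lower_left m n"] eq_matI)
        (auto simp del: index_mult_mat(1) assoc_mult_mat)
  qed
qed

end

theory Submission
  imports Defs
begin

text \<open>With \<open>B\<close> in normal form, taking the upper left block is a Lie algebra homomorphism
  \<open>\<gg>\<^bsup>B\<^esup>\<^bsub>-1\<^esub> \<rightarrow> gl\<^sub>r\<close> with solvable kernel, and \<open>R\<close> is the preimage of the scalars. An ideal with an
  element whose upper left block is not scalar contains an \<open>sl\<^sub>2\<close>-triple of matrix units, so it
  is not solvable. This only uses brackets with off-diagonal matrix units, which lie in \<open>S\<close>, so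
  it applies to the ideals of the whole algebra and to those of \<open>S\<close>.\<close>

section \<open>Submodules and derived series\<close>

lemma submodule_restrict_carrier:
  assumes "submodule K N L" "submodule K H L" "N \<subseteq> H"
  shows "submodule K N (L\<lparr>carrier := H\<rparr>)"
  using assms module.submodule_is_module[OF submodule.module[OF assms(2)] assms(2)]
  unfolding submodule_def by auto

lemma submodule_of_restricted_carrier:
  assumes "submodule K N (L\<lparr>carrier := H\<rparr>)" "submodule K H L"
  shows "submodule K N L"
  using assms unfolding submodule_def by auto

text \<open>An upper bound for the derived series: brackets from \<open>N k\<close> land in the
  submodule \<open>N (Suc k)\<close>, so their span does too. Membership of zero is carried along
  because solvability asks that some term equal the zero space, not merely lie inside it.\<close>

lemma derived_series_filtration:
  assumes L: "module K L"
    and sub: "\<And>k. submodule K (N k) L"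
    and "carrier L \<subseteq> N 0"
    and br: "\<And>k x y. \<lbrakk>x \<in> N k; y \<in> N k\<rbrakk> \<Longrightarrow> lie_bracket L x y \<in> N (Suc k)"
  shows "\<zero>\<^bsub>L\<^esub> \<in> derived_series K L k \<and> derived_series K L k \<subseteq> N k"
proof (induction k)
  case 0
  have "\<zero>\<^bsub>L\<^esub> \<in> carrier L"
    using sub[of 0] by (auto simp: submodule_def)
  then show ?case using assms(3) by simp
next
  case (Suc k)
  let ?G = "{lie_bracket L x y | x y. x \<in> derived_series K L k \<and> y \<in> derived_series K L k}"
  have G: "?G \<subseteq> N (Suc k)" using Suc br by blast
  then have "?G \<subseteq> carrier L" using sub[of "Suc k"] by (auto simp: submodule_def)
  then have "submodule K (LinearCombinations.module.span K L ?G) L"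
    by (rule module.span_is_submodule[OF L])
  then show ?case
    using module.span_is_subset[OF L G sub] by (simp add: submodule_def)
qed

lemma lie_solvable_filtration:
  assumes "module K L"
    and "\<And>k. submodule K (N k) L"
    and "carrier L \<subseteq> N 0"
    and "\<And>k x y. \<lbrakk>x \<in> N k; y \<in> N k\<rbrakk> \<Longrightarrow> lie_bracket L x y \<in> N (Suc k)"
    and "N p \<subseteq> {\<zero>\<^bsub>L\<^esub>}"
  shows "lie_solvable K L"
  using derived_series_filtration[of K L N, OF assms(1-4)] assms(5)
  unfolding lie_solvable_def by blast

text \<open>The matching lower bound. Each element of \<open>T\<close> is a multiple of a bracket of
  two elements of \<open>T\<close>, so \<open>T\<close> survives in every term of the derived
  series, and no term is zero. \<open>T\<close> need not be a subspace; below it is the set of the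
  three elements of an \<open>sl_2\<close>-triple.\<close>

lemma not_lie_solvable_perfect_subset:
  assumes L: "module K L" and T: "T \<subseteq> carrier L"
    and cl: "\<And>x y. \<lbrakk>x \<in> carrier L; y \<in> carrier L\<rbrakk> \<Longrightarrow> lie_bracket L x y \<in> carrier L"
    and perf: "\<And>t. t \<in> T \<Longrightarrow> \<exists>c\<in>carrier K. \<exists>x\<in>T. \<exists>y\<in>T. t = c \<odot>\<^bsub>L\<^esub> lie_bracket L x y"
    and t: "t \<in> T" "t \<noteq> \<zero>\<^bsub>L\<^esub>"
  shows "\<not> lie_solvable K L"
proof -
  have "T \<subseteq> derived_series K L k \<and> derived_series K L k \<subseteq> carrier L" for k
  proof (induction k)
    case 0
    then show ?case using T by simp
  next
    case (Suc k)
    let ?G = "{lie_bracket L x y | x y. x \<in> derived_series K L k \<and> y \<in> derived_series K L k}"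
    have G: "?G \<subseteq> carrier L" using Suc cl by blast
    have sm: "submodule K (LinearCombinations.module.span K L ?G) L"
      by (rule module.span_is_submodule[OF L G])
    have "T \<subseteq> LinearCombinations.module.span K L ?G"
    proof
      fix s assume "s \<in> T"
      then obtain c x y where "c \<in> carrier K" "x \<in> T" "y \<in> T" "s = c \<odot>\<^bsub>L\<^esub> lie_bracket L x y"
        using perf by blast
      moreover from this have "lie_bracket L x y \<in> LinearCombinations.module.span K L ?G"
        using Suc module.in_own_span[OF L G] by blast
      ultimately show "s \<in> LinearCombinations.module.span K L ?G"
        using submodule.smult_closed[OF sm] by simp
    qed
    then show ?case using sm by (simp add: submodule_def)
  qed
  then show ?thesis using t unfolding lie_solvable_def by blast
qed


section \<open>The derived bracket in coordinates\<close>

text \<open>This is \<open>x * b * y - y * b * x\<close> for the normal form block \<open>b\<close>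
  of rank \<open>r\<close>. On the upper left \<open>r\<close> by \<open>r\<close> blocks it is the
  ordinary commutator of \<open>gl_r\<close>.\<close>

definition trunc_comm :: "nat \<Rightarrow> 'a::comm_ring_1 mat \<Rightarrow> 'a mat \<Rightarrow> 'a mat" where
  "trunc_comm r x y = mat (dim_row x) (dim_col x)
     (\<lambda>(i, j). \<Sum>k<r. x $$ (i, k) * y $$ (k, j) - y $$ (i, k) * x $$ (k, j))"

definition mat_unit :: "nat \<Rightarrow> nat \<Rightarrow> nat \<Rightarrow> nat \<Rightarrow> 'a::zero_neq_one mat" where
  "mat_unit n m a b = mat n m (\<lambda>(i, j). if i = a \<and> j = b then 1 else 0)"

text \<open>The entrywise form of membership in \<open>R\<close>. For \<open>r = 0\<close> it holds
  for every \<alpha>, in accordance with \<open>R\<close> being the whole algebra in that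
  case.\<close>

definition block_scalar :: "nat \<Rightarrow> 'a::zero \<Rightarrow> 'a mat \<Rightarrow> bool" where
  "block_scalar r \<alpha> x \<longleftrightarrow> (\<forall>i<r. \<forall>j<r. x $$ (i, j) = (if i = j then \<alpha> else 0))"

definition block_traceless :: "nat \<Rightarrow> 'a::comm_monoid_add mat \<Rightarrow> bool" where
  "block_traceless r x \<longleftrightarrow>
     (\<forall>i<dim_row x. \<forall>j<dim_col x. r \<le> i \<or> r \<le> j \<longrightarrow> x $$ (i, j) = 0) \<and>
     (\<Sum>i<r. x $$ (i, i)) = 0"

lemma trunc_comm_carrier [simp]: "x \<in> carrier_mat n m \<Longrightarrow> trunc_comm r x y \<in> carrier_mat n m"
  by (auto simp: trunc_comm_def)

lemma trunc_comm_dim [simp]: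
  "dim_row (trunc_comm r x y) = dim_row x" "dim_col (trunc_comm r x y) = dim_col x"
  by (simp_all add: trunc_comm_def)

lemma trunc_comm_index:
  "\<lbrakk>x \<in> carrier_mat n m; i < n; j < m\<rbrakk> \<Longrightarrow> trunc_comm r x y $$ (i, j) =
     (\<Sum>k<r. x $$ (i, k) * y $$ (k, j) - y $$ (i, k) * x $$ (k, j))"
  by (auto simp: trunc_comm_def)

lemma mat_unit_carrier [simp]: "mat_unit n m a b \<in> carrier_mat n m"
  by (simp add: mat_unit_def)

lemma mat_unit_index [simp]:
  "\<lbrakk>i < n; j < m\<rbrakk> \<Longrightarrow> mat_unit n m a b $$ (i, j) = (if i = a \<and> j = b then 1 else 0)"
  by (simp add: mat_unit_def)

lemma mat_unit_dim [simp]: "dim_row (mat_unit n m a b) = n" "dim_col (mat_unit n m a b) = m"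
  by (simp_all add: mat_unit_def)

lemma lower_left_eq_iff:
  assumes "x \<in> carrier_mat n m" "y \<in> carrier_mat n m"
  shows "lower_left m n x = lower_left m n y \<longleftrightarrow> x = y"
proof
  assume eq: "lower_left m n x = lower_left m n y"
  show "x = y"
  proof (rule eq_matI)
    fix i j assume "i < dim_row y" "j < dim_col y"
    then show "x $$ (i, j) = y $$ (i, j)"
      using assms arg_cong[OF eq, of "\<lambda>M. M $$ (m + i, j)"] by (simp add: lower_left_def)
  qed (use assms in auto)
qed simp

text \<open>Replaces the block decomposition by conditions on entries, so that brackets can be
  computed entry by entry with \<open>trunc_comm\<close>.\<close>

lemma radical_part_coords:
  assumes "r \<le> m" "r \<le> n"
  shows "radical_part m n r =
    lower_left m n ` {x \<in> carrier_mat n m. \<exists>\<alpha>. block_scalar r \<alpha> (x :: 'a::comm_ring_1 mat)}"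
    (is "_ = lower_left m n ` ?A")
proof
  show "radical_part m n r \<subseteq> lower_left m n ` ?A"
  proof
    fix z :: "'a mat" assume "z \<in> radical_part m n r"
    then obtain \<alpha> X12 X21 X22 where
      z: "z = lower_left m n (four_block_mat (\<alpha> \<cdot>\<^sub>m 1\<^sub>m r) X12 X21 X22)"
      and X: "X12 \<in> carrier_mat r (m - r)" "X21 \<in> carrier_mat (n - r) r"
        "X22 \<in> carrier_mat (n - r) (m - r)"
      unfolding radical_part_def by blast
    have "four_block_mat (\<alpha> \<cdot>\<^sub>m 1\<^sub>m r) X12 X21 X22 \<in> carrier_mat (r + (n - r)) (r + (m - r))"
      using X by (intro four_block_carrier_mat) auto
    moreover have "block_scalar r \<alpha> (four_block_mat (\<alpha> \<cdot>\<^sub>m 1\<^sub>m r) X12 X21 X22)"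
      using X by (auto simp: block_scalar_def)
    ultimately show "z \<in> lower_left m n ` ?A"
      using z assms by auto
  qed
  show "lower_left m n ` ?A \<subseteq> radical_part m n r"
  proof
    fix z assume "z \<in> lower_left m n ` ?A"
    then obtain x \<alpha> where z: "z = lower_left m n x" and x: "x \<in> carrier_mat n m"
      and s: "block_scalar r \<alpha> x" by blast
    let ?X12 = "mat r (m - r) (\<lambda>(i, j). x $$ (i, j + r))"
      and ?X21 = "mat (n - r) r (\<lambda>(i, j). x $$ (i + r, j))"
      and ?X22 = "mat (n - r) (m - r) (\<lambda>(i, j). x $$ (i + r, j + r))"
    have "x = four_block_mat (\<alpha> \<cdot>\<^sub>m 1\<^sub>m r) ?X12 ?X21 ?X22"
      by (rule eq_matI) (use x s assms in \<open>auto simp: block_scalar_def\<close>)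
    then show "z \<in> radical_part m n r"
      unfolding radical_part_def z
      by (intro CollectI exI[of _ \<alpha>] exI[of _ ?X12] exI[of _ ?X21] exI[of _ ?X22]) simp
  qed
qed

lemma levi_part_coords:
  assumes "r \<le> m" "r \<le> n"
  shows "levi_part m n r =
    lower_left m n ` {x \<in> carrier_mat n m. block_traceless r (x :: 'a::comm_ring_1 mat)}"
    (is "_ = lower_left m n ` ?A")
proof -
  let ?F = "\<lambda>X :: 'a mat. four_block_mat X (0\<^sub>m r (m - r)) (0\<^sub>m (n - r) r) (0\<^sub>m (n - r) (m - r))"
  show ?thesis
  proof
    show "levi_part m n r \<subseteq> lower_left m n ` ?A"
    proof
      fix z :: "'a mat" assume "z \<in> levi_part m n r"
      then obtain X where z: "z = lower_left m n (?F X)"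
        and X: "X \<in> carrier_mat r r" "mat_trace X = 0"
        unfolding levi_part_def by blast
      have "?F X \<in> carrier_mat (r + (n - r)) (r + (m - r))"
        using X by (intro four_block_carrier_mat) auto
      moreover have "block_traceless r (?F X)"
        using X by (auto simp: block_traceless_def mat_trace_def)
      ultimately show "z \<in> lower_left m n ` ?A"
        using z assms by auto
    qed
    show "lower_left m n ` ?A \<subseteq> levi_part m n r"
    proof
      fix z assume "z \<in> lower_left m n ` ?A"
      then obtain x where z: "z = lower_left m n x" and x: "x \<in> carrier_mat n m"
        and s: "block_traceless r x" by blast
      let ?X = "mat r r (\<lambda>ij. x $$ ij)"
      have "x = ?F ?X"
        by (rule eq_matI) (use x s assms in \<open>auto simp: block_traceless_def\<close>)
      moreover have "mat_trace ?X = 0"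
        using s by (simp add: mat_trace_def block_traceless_def)
      ultimately show "z \<in> levi_part m n r"
        unfolding levi_part_def z by (auto intro!: exI[of _ ?X])
    qed
  qed
qed

lemma mult_mat_index_sum:
  assumes "A \<in> carrier_mat p q" "C \<in> carrier_mat q s" "i < p" "j < s"
  shows "(A * C) $$ (i, j) = (\<Sum>k<q. A $$ (i, k) * C $$ (k, j))"
  using assms by (simp add: scalar_prod_def atLeast0LessThan)

locale normal_form_bracket =
  fixes m n r :: nat and L :: "('k::field_char_0, 'k mat) lie_alg"
  assumes rm: "r \<le> m" and rn: "r \<le> n"
    and L: "L = gl_minus_derived m n (normal_form m n r)"
begin

lemma is_lie_algebra: "lie_algebra class_ring L"
  unfolding L by (rule lie_algebra_gl_minus_derived[OF normal_form_in_gl_plus[OF rm rn]])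

lemma is_module: "module class_ring L"
  using is_lie_algebra by (simp add: lie_algebra_def vectorspace_def)

lemma carrier_L: "carrier L = lower_left m n ` carrier_mat n m"
  and add_L: "add L = (+)" and smult_L: "smult L = (\<cdot>\<^sub>m)"
  and zero_L: "zero L = lower_left m n (0\<^sub>m n m)"
  by (simp_all add: L gl_minus_derived_def gl_minus_def lower_left_zero)

text \<open>Right multiplication by the normal form block keeps the first \<open>r\<close> columns
  of a matrix and kills the others, so the inner sum of \<open>u * b * v\<close> stops at
  \<open>r\<close>.\<close>

lemma bracket_coords:
  assumes x: "x \<in> carrier_mat n m" and y: "y \<in> carrier_mat n m"
  shows "lie_bracket L (lower_left m n x) (lower_left m n y) = lower_left m n (trunc_comm r x y)"
proof -
  define b :: "'k mat" where
    "b = four_block_mat (1\<^sub>m r) (0\<^sub>m r (n - r)) (0\<^sub>m (m - r) r) (0\<^sub>m (m - r) (n - r))"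
  have "b \<in> carrier_mat (r + (m - r)) (r + (n - r))"
    unfolding b_def by (rule four_block_carrier_mat) auto
  then have b: "b \<in> carrier_mat m n" using rm rn by simp
  have b_index: "b $$ (k, l) = (if k = l \<and> l < r then 1 else 0)" if "k < m" "l < n" for k l
    using that rm rn by (auto simp: b_def)
  have prod: "(u * b * v) $$ (i, j) = (\<Sum>k<r. u $$ (i, k) * v $$ (k, j))"
    if u: "u \<in> carrier_mat n m" and v: "v \<in> carrier_mat n m" and ij: "i < n" "j < m" for u v i j
  proof -
    have ub: "(u * b) $$ (i, l) = (if l < r then u $$ (i, l) else 0)" if "l < n" for l
    proof -
      have "(u * b) $$ (i, l) = (\<Sum>k<m. u $$ (i, k) * b $$ (k, l))"
        by (rule mult_mat_index_sum[OF u b ij(1) that])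
      also have "\<dots> = (\<Sum>k<m. if k = l then (if l < r then u $$ (i, l) else 0) else 0)"
        by (rule sum.cong) (use that in \<open>auto simp: b_index\<close>)
      finally show ?thesis using rm by auto
    qed
    have "(u * b * v) $$ (i, j) = (\<Sum>l<n. (u * b) $$ (i, l) * v $$ (l, j))"
      by (rule mult_mat_index_sum[OF mult_carrier_mat[OF u b] v ij])
    also have "\<dots> = (\<Sum>l<n. if l < r then u $$ (i, l) * v $$ (l, j) else 0)"
      by (rule sum.cong) (auto simp: ub)
    also have "\<dots> = (\<Sum>l\<in>{l\<in>{..<n}. l < r}. u $$ (i, l) * v $$ (l, j))"
      by (rule sum.inter_filter[symmetric]) simp
    also have "{l\<in>{..<n}. l < r} = {..<r}" using rn by auto
    finally show ?thesis .
  qed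
  have "x * b * y - y * b * x = trunc_comm r x y"
  proof (rule eq_matI)
    fix i j assume "i < dim_row (trunc_comm r x y)" "j < dim_col (trunc_comm r x y)"
    then have ij: "i < n" "j < m" using x by (auto simp: trunc_comm_def)
    have "(x * b * y - y * b * x) $$ (i, j) = (x * b * y) $$ (i, j) - (y * b * x) $$ (i, j)"
      using x y b ij by (intro index_minus_mat) auto
    then show "(x * b * y - y * b * x) $$ (i, j) = trunc_comm r x y $$ (i, j)"
      using ij by (simp add: prod[OF x y] prod[OF y x] trunc_comm_index[OF x] sum_subtractf)
  qed (use x y in \<open>auto simp: trunc_comm_def\<close>)
  then show ?thesis
    using derived_bracket_eq[OF b x y]
    by (simp add: L gl_minus_derived_def normal_form_def b_def)
qed

lemma submodule_coords:
  assumes "P (0\<^sub>m n m)"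
    and "\<And>x y. \<lbrakk>x \<in> carrier_mat n m; y \<in> carrier_mat n m; P x; P y\<rbrakk> \<Longrightarrow> P (x + y)"
    and "\<And>a x. \<lbrakk>x \<in> carrier_mat n m; P x\<rbrakk> \<Longrightarrow> P (a \<cdot>\<^sub>m x)"
  shows "submodule class_ring (lower_left m n ` {x \<in> carrier_mat n m. P x}) L"
proof (rule submodule.intro[OF is_module])
qed (use assms in \<open>auto simp: carrier_L add_L smult_L zero_L lower_left_add lower_left_smult\<close>)


section \<open>The radical\<close>

text \<open>The upper left block is scalar for \<open>k = 0\<close> and vanishes for \<open>k = 1\<close>, only the lower right
  block survives for \<open>k = 2\<close>, and nothing is left from \<open>k = 3\<close> on.\<close>

definition radical_filtration :: "nat \<Rightarrow> 'k mat set" where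
  "radical_filtration k = lower_left m n ` {x \<in> carrier_mat n m.
     (\<exists>\<alpha>. block_scalar r \<alpha> x \<and> (0 < k \<longrightarrow> \<alpha> = 0)) \<and>
     (\<forall>i<n. \<forall>j<m. 2 \<le> k \<and> (i < r \<or> j < r) \<or> 3 \<le> k \<longrightarrow> x $$ (i, j) = 0)}"

lemma radical_filtration_submodule: "submodule class_ring (radical_filtration k) L"
  unfolding radical_filtration_def
proof (rule submodule_coords, goal_cases)
  case 1
  show ?case using rm rn by (auto simp: block_scalar_def intro!: exI[of _ 0])
next
  case (2 x y)
  then obtain \<alpha> \<beta> where "block_scalar r \<alpha> x" "block_scalar r \<beta> y" "0 < k \<longrightarrow> \<alpha> = 0 \<and> \<beta> = 0"
    by blast
  with 2 show ?case
    using rm rn by (auto simp: block_scalar_def intro!: exI[of _ "\<alpha> + \<beta>"])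
next
  case (3 a x)
  then obtain \<alpha> where "block_scalar r \<alpha> x" "0 < k \<longrightarrow> \<alpha> = 0"
    by blast
  with 3 show ?case
    using rm rn by (auto simp: block_scalar_def intro!: exI[of _ "a * \<alpha>"])
qed

lemma radical_filtration_0: "radical_filtration 0 = radical_part m n r"
  unfolding radical_filtration_def radical_part_coords[OF rm rn] by simp

lemma radical_filtration_3: "radical_filtration 3 \<subseteq> {\<zero>\<^bsub>L\<^esub>}"
  unfolding radical_filtration_def zero_L
  by (auto intro!: arg_cong[of _ _ "lower_left m n"] eq_matI)

lemma radical_filtration_subset: "radical_filtration k \<subseteq> radical_part m n r"
  unfolding radical_filtration_def radical_part_coords[OF rm rn] by blast

text \<open>The inner index \<open>l\<close> of the bracket is below \<open>r\<close>. For
  \<open>k = 0\<close>, the upper left block of the bracket is a commutator of scalar matrices. For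
  \<open>k = 1\<close>, an entry with \<open>i < r\<close> or \<open>j < r\<close> has in each
  product a factor from a vanishing upper left block. From \<open>k = 2\<close> on, columns below
  \<open>r\<close> vanish, so every product is zero.\<close>

lemma radical_filtration_bracket:
  assumes "X \<in> radical_filtration k" "Y \<in> radical_filtration k"
  shows "lie_bracket L X Y \<in> radical_filtration (Suc k)"
proof -
  from assms(1) obtain x \<alpha> where X: "X = lower_left m n x" and x: "x \<in> carrier_mat n m"
    and sx: "\<And>i j. \<lbrakk>i < r; j < r\<rbrakk> \<Longrightarrow> x $$ (i, j) = (if i = j then \<alpha> else 0)"
    and x0: "\<And>i j. \<lbrakk>i < n; j < m; 1 \<le> k; i < r; j < r\<rbrakk> \<Longrightarrow> x $$ (i, j) = 0"
      "\<And>i j. \<lbrakk>i < n; j < m; 2 \<le> k; i < r \<or> j < r\<rbrakk> \<Longrightarrow> x $$ (i, j) = 0"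
    unfolding radical_filtration_def block_scalar_def by fastforce
  from assms(2) obtain y \<beta> where Y: "Y = lower_left m n y" and y: "y \<in> carrier_mat n m"
    and sy: "\<And>i j. \<lbrakk>i < r; j < r\<rbrakk> \<Longrightarrow> y $$ (i, j) = (if i = j then \<beta> else 0)"
    and y0: "\<And>i j. \<lbrakk>i < n; j < m; 1 \<le> k; i < r; j < r\<rbrakk> \<Longrightarrow> y $$ (i, j) = 0"
      "\<And>i j. \<lbrakk>i < n; j < m; 2 \<le> k; i < r \<or> j < r\<rbrakk> \<Longrightarrow> y $$ (i, j) = 0"
    unfolding radical_filtration_def block_scalar_def by fastforce
  have 1: "trunc_comm r x y $$ (i, j) = 0" if "i < r" "j < r" for i j
    unfolding trunc_comm_index[OF x less_le_trans[OF that(1) rn] less_le_trans[OF that(2) rm]]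
    by (rule sum.neutral) (use that in \<open>auto simp: sx sy\<close>)
  \<comment> \<open>The condition on \<open>k\<close> is the vanishing condition of
    \<open>radical_filtration\<close> at \<open>Suc k\<close>, with the bounds lowered by
    one.\<close>
  have 2: "trunc_comm r x y $$ (i, j) = 0"
    if ij: "i < n" "j < m" "1 \<le> k \<and> (i < r \<or> j < r) \<or> 2 \<le> k" for i j
    unfolding trunc_comm_index[OF x ij(1,2)]
  proof (rule sum.neutral, rule ballI)
    fix l assume "l \<in> {..<r}"
    then have l: "l < r" "l < n" "l < m" using rm rn by auto
    consider "1 \<le> k" "i < r" | "1 \<le> k" "j < r" | "2 \<le> k" using ij(3) by blast
    then show "x $$ (i, l) * y $$ (l, j) - y $$ (i, l) * x $$ (l, j) = 0"
      by cases (use ij l in \<open>simp_all add: x0 y0\<close>)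
  qed
  have "block_scalar r 0 (trunc_comm r x y)"
    using 1 by (auto simp: block_scalar_def)
  then show ?thesis
    unfolding X Y bracket_coords[OF x y] radical_filtration_def using x 2 by auto
qed

lemma radical_part_submodule: "submodule class_ring (radical_part m n r) L"
  using radical_filtration_submodule[of 0] unfolding radical_filtration_0 .

lemma radical_part_solvable: "lie_solvable class_ring (L\<lparr>carrier := radical_part m n r\<rparr>)"
proof (rule lie_solvable_filtration[where N = radical_filtration and p = 3])
  show "module class_ring (L\<lparr>carrier := radical_part m n r\<rparr>)"
    by (rule module.submodule_is_module[OF is_module radical_part_submodule])
  show "submodule class_ring (radical_filtration k) (L\<lparr>carrier := radical_part m n r\<rparr>)" for k
    by (rule submodule_restrict_carrier[OF radical_filtration_submodule radical_part_submodule
          radical_filtration_subset])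
qed (use radical_filtration_3 in \<open>auto simp: radical_filtration_0 intro: radical_filtration_bracket\<close>)

text \<open>Scalar matrices are central in \<open>gl_r\<close>, so a bracket with an element of
  \<open>R\<close> even has upper left block zero.\<close>

lemma radical_part_ideal: "lie_ideal class_ring L (radical_part m n r)"
  unfolding lie_ideal_def
proof (intro conjI radical_part_submodule ballI)
  fix X Y :: "'k mat"
  assume "X \<in> carrier L" "Y \<in> radical_part m n r"
  then obtain x y \<alpha> where X: "X = lower_left m n x" and x: "x \<in> carrier_mat n m"
    and Y: "Y = lower_left m n y" and y: "y \<in> carrier_mat n m"
    and s: "\<And>i j. \<lbrakk>i < r; j < r\<rbrakk> \<Longrightarrow> y $$ (i, j) = (if i = j then \<alpha> else 0)"
    unfolding carrier_L radical_part_coords[OF rm rn] block_scalar_def by blast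
  have "trunc_comm r x y $$ (i, j) = 0" if ij: "i < r" "j < r" for i j
  proof -
    have "trunc_comm r x y $$ (i, j) =
        (\<Sum>k<r. (if k = j then x $$ (i, j) * \<alpha> else 0) - (if k = i then \<alpha> * x $$ (i, j) else 0))"
      unfolding trunc_comm_index[OF x less_le_trans[OF ij(1) rn] less_le_trans[OF ij(2) rm]]
      by (rule sum.cong) (use ij in \<open>auto simp: s\<close>)
    then show ?thesis using ij by (simp add: sum_subtractf)
  qed
  then have "block_scalar r 0 (trunc_comm r x y)" by (auto simp: block_scalar_def)
  then show "lie_bracket L X Y \<in> radical_part m n r"
    unfolding X Y bracket_coords[OF x y] radical_part_coords[OF rm rn] using x by auto
qed


section \<open>Solvable ideals\<close>

text \<open>Left multiplication by \<open>E_ab\<close> moves row \<open>b\<close> to row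
  \<open>a\<close>, right multiplication moves column \<open>a\<close> to column \<open>b\<close>.
  The bounds \<open>a < r\<close> and \<open>b < r\<close> keep both terms inside the truncated
  sum.\<close>

lemma trunc_comm_mat_unit:
  assumes x: "x \<in> carrier_mat n m" and ab: "a < r" "b < r" and ij: "i < n" "j < m"
  shows "trunc_comm r (mat_unit n m a b) x $$ (i, j) =
    (if i = a then x $$ (b, j) else 0) - (if j = b then x $$ (i, a) else 0)"
proof -
  have "trunc_comm r (mat_unit n m a b) x $$ (i, j) =
      (\<Sum>k<r. (if k = b then if i = a then x $$ (b, j) else 0 else 0) -
        (if k = a then if j = b then x $$ (i, a) else 0 else 0))"
    unfolding trunc_comm_index[OF mat_unit_carrier ij]
    by (rule sum.cong) (use ij rm rn in auto)
  then show ?thesis using ab by (simp add: sum_subtractf)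
qed

text \<open>For \<open>a \<noteq> b\<close> the matrix unit \<open>E\<close> squares to zero under
  the truncated product, so \<open>[E, [E, x]]\<close> reduces to \<open>-2 E x E\<close>, and
  \<open>E x E\<close> is the entry \<open>x $$ (b, a)\<close> times \<open>E\<close>.\<close>

lemma double_trunc_comm_mat_unit:
  assumes x: "x \<in> carrier_mat n m" and ab: "a < r" "b < r" "a \<noteq> b"
  shows "trunc_comm r (mat_unit n m a b) (trunc_comm r (mat_unit n m a b) x) =
    (- 2 * x $$ (b, a)) \<cdot>\<^sub>m mat_unit n m a b"
proof (rule eq_matI)
  fix i j assume "i < dim_row ((- 2 * x $$ (b, a)) \<cdot>\<^sub>m mat_unit n m a b)"
    "j < dim_col ((- 2 * x $$ (b, a)) \<cdot>\<^sub>m mat_unit n m a b)"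
  then have ij: "i < n" "j < m" by auto
  have c: "trunc_comm r (mat_unit n m a b) x \<in> carrier_mat n m" by simp
  have lt: "a < n" "a < m" "b < n" "b < m" using ab rm rn by auto
  show "trunc_comm r (mat_unit n m a b) (trunc_comm r (mat_unit n m a b) x) $$ (i, j) =
      ((- 2 * x $$ (b, a)) \<cdot>\<^sub>m mat_unit n m a b) $$ (i, j)"
    using ab ij lt
    by (simp add: trunc_comm_mat_unit[OF c] trunc_comm_mat_unit[OF x])
qed (auto simp: trunc_comm_def)

text \<open>For a nonzero entry \<open>x $$ (b, a)\<close> off the diagonal, \<open>[E, [E, x]]\<close> with \<open>E = E\<^bsub>ab\<^esub>\<close> is a
  nonzero multiple of \<open>E\<close>; a second application yields \<open>E\<^bsub>ba\<^esub>\<close>, hence an \<open>sl\<^sub>2\<close>-triple.\<close>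

lemma ideal_not_solvable_off_diagonal:
  assumes I: "submodule class_ring I L"
    and br: "\<And>X Y. \<lbrakk>X \<in> I; Y \<in> I\<rbrakk> \<Longrightarrow> lie_bracket L X Y \<in> I"
    and unit: "\<And>a b Y. \<lbrakk>a < r; b < r; a \<noteq> b; Y \<in> I\<rbrakk> \<Longrightarrow>
      lie_bracket L (lower_left m n (mat_unit n m a b)) Y \<in> I"
    and X: "lower_left m n x \<in> I" and x: "x \<in> carrier_mat n m"
    and ab: "a < r" "b < r" "a \<noteq> b" and nz: "x $$ (b, a) \<noteq> 0"
  shows "\<not> lie_solvable class_ring (L\<lparr>carrier := I\<rparr>)"
proof -
  have lt: "a < n" "a < m" "b < n" "b < m" using ab rm rn by auto
  have step: "lower_left m n (mat_unit n m p q) \<in> I"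
    if Y: "lower_left m n y \<in> I" and y: "y \<in> carrier_mat n m"
      and pq: "p < r" "q < r" "p \<noteq> q" and nzy: "y $$ (q, p) \<noteq> 0" for y p q
  proof -
    let ?E = "mat_unit n m p q :: 'k mat"
    have "lower_left m n (trunc_comm r ?E (trunc_comm r ?E y)) \<in> I"
      using unit[OF pq unit[OF pq Y]] y by (simp add: bracket_coords)
    \<comment> \<open>The division is meaningful because 2 is nonzero in characteristic
      zero.\<close>
    then have "(1 / (- 2 * y $$ (q, p))) \<cdot>\<^sub>m lower_left m n ((- 2 * y $$ (q, p)) \<cdot>\<^sub>m ?E) \<in> I"
      using submodule.smult_closed[OF I, of "1 / (- 2 * y $$ (q, p))"]
      unfolding double_trunc_comm_mat_unit[OF y pq] by (simp add: smult_L)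
    moreover have "(1 / (- 2 * y $$ (q, p))) \<cdot>\<^sub>m ((- 2 * y $$ (q, p)) \<cdot>\<^sub>m ?E) = ?E"
      using nzy by (intro eq_matI) auto
    ultimately show ?thesis
      by (simp add: lower_left_smult del: mult_minus_left)
  qed
  let ?e = "mat_unit n m a b :: 'k mat" and ?f = "mat_unit n m b a :: 'k mat"
  let ?h = "trunc_comm r ?e ?f"
  let ?l = "lower_left m n"
  have e: "?l ?e \<in> I" by (rule step[OF X x ab nz])
  have f: "?l ?f \<in> I" by (rule step[OF e]) (use ab lt in auto)
  have h: "?l ?h \<in> I" using br[OF e f] by (simp add: bracket_coords)
  have eh: "?l ?e = (- (1 / 2)) \<odot>\<^bsub>L\<^esub> lie_bracket L (?l ?e) (?l ?h)"
  proof -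
    \<comment> \<open>Since \<open>?h\<close> is \<open>[e, f]\<close> and the entry of
      \<open>?f\<close> at \<open>(b, a)\<close> is 1, the double bracket formula gives
      \<open>[e, h] = -2 e\<close>.\<close>
    have "?e = (- (1 / 2)) \<cdot>\<^sub>m trunc_comm r ?e ?h"
      unfolding double_trunc_comm_mat_unit[OF mat_unit_carrier ab]
      by (rule eq_matI) (use lt in auto)
    then show ?thesis by (simp add: bracket_coords smult_L lower_left_smult)
  qed
  have fh: "?l ?f = (1 / 2) \<odot>\<^bsub>L\<^esub> lie_bracket L (?l ?f) (?l ?h)"
  proof -
    \<comment> \<open>Here \<open>?h\<close> is \<open>[e, f]\<close> and not \<open>[f, e]\<close>,
      so the double bracket formula does not match literally; \<open>[f, h] = 2 f\<close> is checked
      on entries.\<close>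
    have "?f = (1 / 2) \<cdot>\<^sub>m trunc_comm r ?f ?h"
    proof (rule eq_matI)
      fix i j assume "i < dim_row ((1 / 2) \<cdot>\<^sub>m trunc_comm r ?f ?h)"
        "j < dim_col ((1 / 2) \<cdot>\<^sub>m trunc_comm r ?f ?h)"
      then have ij: "i < n" "j < m" by (auto simp: trunc_comm_def)
      show "?f $$ (i, j) = ((1 / 2) \<cdot>\<^sub>m trunc_comm r ?f ?h) $$ (i, j)"
        using ij ab lt
        by (simp add: trunc_comm_mat_unit)
    qed (auto simp: trunc_comm_def)
    then show ?thesis by (simp add: bracket_coords smult_L lower_left_smult)
  qed
  have hef: "?l ?h = 1 \<odot>\<^bsub>L\<^esub> lie_bracket L (?l ?e) (?l ?f)"
  proof -
    have "?h = 1 \<cdot>\<^sub>m ?h" by (rule eq_matI) auto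
    then show ?thesis by (simp add: bracket_coords smult_L lower_left_smult)
  qed
  have "?e $$ (a, b) \<noteq> 0\<^sub>m n m $$ (a, b)" using lt by simp
  then have nz: "?l ?e \<noteq> \<zero>\<^bsub>L\<^esub>" by (subst zero_L, subst lower_left_eq_iff) auto
  show ?thesis
  proof (rule not_lie_solvable_perfect_subset[where T = "{?l ?e, ?l ?f, ?l ?h}" and t = "?l ?e"])
    show "module class_ring (L\<lparr>carrier := I\<rparr>)"
      by (rule module.submodule_is_module[OF is_module I])
    show "\<exists>c\<in>carrier class_ring. \<exists>x\<in>{?l ?e, ?l ?f, ?l ?h}. \<exists>y\<in>{?l ?e, ?l ?f, ?l ?h}.
        t = c \<odot>\<^bsub>L\<lparr>carrier := I\<rparr>\<^esub> lie_bracket (L\<lparr>carrier := I\<rparr>) x y"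
      if "t \<in> {?l ?e, ?l ?f, ?l ?h}" for t
    proof -
      have "\<exists>c. \<exists>x\<in>{?l ?e, ?l ?f, ?l ?h}. \<exists>y\<in>{?l ?e, ?l ?f, ?l ?h}. t = c \<odot>\<^bsub>L\<^esub> lie_bracket L x y"
        using that eh fh hef by blast
      then show ?thesis by simp
    qed
  qed (use e f h br nz in auto)
qed

text \<open>Off-diagonal entries of the upper left block vanish by the \<open>sl_2\<close> argument.
  This applies to \<open>[E_ij, x]\<close> as well, whose entry at \<open>(i, j)\<close> is
  \<open>x $$ (j, j) - x $$ (i, i)\<close>, so the diagonal is constant.\<close>

lemma solvable_ideal_block_scalar:
  assumes I: "submodule class_ring I L"
    and br: "\<And>X Y. \<lbrakk>X \<in> I; Y \<in> I\<rbrakk> \<Longrightarrow> lie_bracket L X Y \<in> I"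
    and unit: "\<And>a b Y. \<lbrakk>a < r; b < r; a \<noteq> b; Y \<in> I\<rbrakk> \<Longrightarrow>
      lie_bracket L (lower_left m n (mat_unit n m a b)) Y \<in> I"
    and sol: "lie_solvable class_ring (L\<lparr>carrier := I\<rparr>)"
    and X: "lower_left m n x \<in> I" and x: "x \<in> carrier_mat n m"
  shows "\<exists>\<alpha>. block_scalar r \<alpha> x"
proof -
  have off: "y $$ (i, j) = 0"
    if "lower_left m n y \<in> I" "y \<in> carrier_mat n m" "i < r" "j < r" "i \<noteq> j" for y i j
    using ideal_not_solvable_off_diagonal[OF I br unit that(1,2,4,3)] that(5) sol by blast
  have diag: "x $$ (i, i) = x $$ (j, j)" if ij: "i < r" "j < r" "i \<noteq> j" for i j
  proof -
    let ?y = "trunc_comm r (mat_unit n m i j) x"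
    have "lower_left m n ?y \<in> I" using unit[OF ij X] by (simp add: bracket_coords x)
    then have "?y $$ (i, j) = 0" using ij by (intro off) auto
    then show ?thesis using ij rm rn by (simp add: trunc_comm_mat_unit[OF x])
  qed
  have "x $$ (i, i) = x $$ (0, 0)" if "i < r" for i
    using diag[of i 0] that by (cases "i = 0") auto
  \<comment> \<open>For \<open>r = 0\<close> the claim is vacuous, so the choice of the scalar is
    harmless.\<close>
  then have "block_scalar r (x $$ (0, 0)) x"
    unfolding block_scalar_def using off[OF X x] by presburger
  then show ?thesis ..
qed

lemma radical_part_is_radical: "is_lie_radical class_ring L (radical_part m n r)"
  unfolding is_lie_radical_def
proof (intro conjI allI impI radical_part_ideal radical_part_solvable subsetI)
  fix I X
  assume I: "lie_ideal class_ring L I \<and> lie_solvable class_ring (L\<lparr>carrier := I\<rparr>)" and X: "X \<in> I"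
  then have sub: "submodule class_ring I L"
    and br: "\<And>X Y. \<lbrakk>X \<in> carrier L; Y \<in> I\<rbrakk> \<Longrightarrow> lie_bracket L X Y \<in> I"
    by (auto simp: lie_ideal_def)
  have IL: "I \<subseteq> carrier L" using sub by (rule submodule.subset)
  then obtain x where x: "x \<in> carrier_mat n m" "X = lower_left m n x"
    using X unfolding carrier_L by blast
  have "\<exists>\<alpha>. block_scalar r \<alpha> x"
    by (rule solvable_ideal_block_scalar[OF sub])
      (use I X x IL in \<open>auto simp: carrier_L intro!: br\<close>)
  then show "X \<in> radical_part m n r"
    unfolding radical_part_coords[OF rm rn] using x by blast
qed


section \<open>The Levi subalgebra\<close>

lemma levi_part_submodule: "submodule class_ring (levi_part m n r) L"
  unfolding levi_part_coords[OF rm rn]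
  by (rule submodule_coords)
    (use rm rn in \<open>auto simp: block_traceless_def sum.distrib simp flip: sum_distrib_left\<close>)

lemma levi_part_subalgebra: "lie_subalgebra class_ring L (levi_part m n r)"
  unfolding lie_subalgebra_def
proof (intro conjI levi_part_submodule ballI)
  fix X Y :: "'k mat"
  assume "X \<in> levi_part m n r" "Y \<in> levi_part m n r"
  then obtain x y where X: "X = lower_left m n x" and x: "x \<in> carrier_mat n m"
    and Y: "Y = lower_left m n y" and y: "y \<in> carrier_mat n m"
    and s: "block_traceless r x" "block_traceless r y"
    unfolding levi_part_coords[OF rm rn] by blast
  have "trunc_comm r x y $$ (i, j) = 0" if ij: "i < n" "j < m" "r \<le> i \<or> r \<le> j" for i j
    unfolding trunc_comm_index[OF x ij(1,2)]
    by (rule sum.neutral) (use ij x y s rm rn in \<open>auto simp: block_traceless_def\<close>)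
  moreover have "(\<Sum>i<r. trunc_comm r x y $$ (i, i)) = 0"
  proof -
    have "(\<Sum>i<r. trunc_comm r x y $$ (i, i)) =
        (\<Sum>i<r. \<Sum>k<r. x $$ (i, k) * y $$ (k, i)) - (\<Sum>i<r. \<Sum>k<r. y $$ (i, k) * x $$ (k, i))"
      using rm rn by (simp add: trunc_comm_index[OF x] sum_subtractf)
    \<comment> \<open>Symmetry of the trace of a product of two upper left blocks.\<close>
    also have "(\<Sum>i<r. \<Sum>k<r. y $$ (i, k) * x $$ (k, i)) = (\<Sum>i<r. \<Sum>k<r. x $$ (i, k) * y $$ (k, i))"
      by (subst sum.swap) (simp add: mult.commute)
    finally show ?thesis by simp
  qed
  ultimately have "block_traceless r (trunc_comm r x y)"
    using x by (simp add: block_traceless_def)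
  then show "lie_bracket L X Y \<in> levi_part m n r"
    unfolding X Y bracket_coords[OF x y] levi_part_coords[OF rm rn] using x by auto
qed

text \<open>The trace of the upper left block is \<open>r\<close> times \<alpha>, and characteristic
  zero forces \<open>r = 0\<close> or a zero scalar. This yields both that \<open>S\<close> meets
  \<open>R\<close> trivially and that \<open>S\<close> has no nonzero solvable ideal.\<close>

lemma block_scalar_traceless:
  assumes x: "x \<in> carrier_mat n m" and "block_scalar r \<alpha> x" "block_traceless r x"
  shows "x = (0\<^sub>m n m :: 'k mat)"
proof -
  have "(\<Sum>i<r. x $$ (i, i)) = of_nat r * \<alpha>"
    using assms(2) by (simp add: block_scalar_def)
  then have "r = 0 \<or> \<alpha> = 0"
    using assms(3) by (simp add: block_traceless_def)
  then have "x $$ (i, j) = 0" if "i < r" "j < r" for i j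
    using assms(2) that by (auto simp: block_scalar_def)
  then show ?thesis
    using x assms(3) by (intro eq_matI) (auto simp: block_traceless_def not_less[symmetric])
qed

lemma levi_inter_radical: "levi_part m n r \<inter> radical_part m n r = {\<zero>\<^bsub>L\<^esub>}"
proof
  show "levi_part m n r \<inter> radical_part m n r \<subseteq> {\<zero>\<^bsub>L\<^esub>}"
    unfolding levi_part_coords[OF rm rn] radical_part_coords[OF rm rn] zero_L
    by (auto simp: lower_left_eq_iff dest: block_scalar_traceless)
  show "{\<zero>\<^bsub>L\<^esub>} \<subseteq> levi_part m n r \<inter> radical_part m n r"
    using submodule.zero_closed[OF levi_part_submodule]
      submodule.zero_closed[OF radical_part_submodule] by simp
qed

text \<open>An ideal of \<open>S\<close> need not be an ideal of \<open>L\<close>, but off-diagonal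
  matrix units are traceless and so lie in \<open>S\<close>. Hence elements of a solvable ideal of
  \<open>S\<close> have scalar upper left block, and being traceless they are zero.\<close>

lemma levi_part_semisimple: "lie_semisimple class_ring (L\<lparr>carrier := levi_part m n r\<rparr>)"
proof -
  let ?S = "levi_part m n r" and ?M = "L\<lparr>carrier := levi_part m n r\<rparr>"
  have zero: "submodule class_ring {\<zero>\<^bsub>L\<^esub>} L"
  proof -
    have "{\<zero>\<^bsub>L\<^esub>} = lower_left m n ` {x \<in> carrier_mat n m. x = 0\<^sub>m n m}"
      by (auto simp: zero_L)
    then show ?thesis using submodule_coords[of "\<lambda>x. x = 0\<^sub>m n m"] by simp
  qed
  have SL: "?S \<subseteq> carrier L" by (rule submodule.subset[OF levi_part_submodule])
  have "lie_bracket L X \<zero>\<^bsub>L\<^esub> = \<zero>\<^bsub>L\<^esub>" if X: "X \<in> carrier L" for X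
  proof -
    obtain x where x: "X = lower_left m n x" "x \<in> carrier_mat n m"
      using X unfolding carrier_L by blast
    have "trunc_comm r x (0\<^sub>m n m) = 0\<^sub>m n m"
      by (rule eq_matI) (use x rm rn in \<open>auto simp: trunc_comm_def intro!: sum.neutral\<close>)
    then show ?thesis using x by (simp add: zero_L bracket_coords)
  qed
  then have "lie_ideal class_ring ?M {\<zero>\<^bsub>L\<^esub>}"
    using submodule_restrict_carrier[OF zero levi_part_submodule]
      submodule.zero_closed[OF levi_part_submodule] SL
    by (auto simp: lie_ideal_def)
  moreover have "lie_solvable class_ring (L\<lparr>carrier := {\<zero>\<^bsub>L\<^esub>}\<rparr>)"
    unfolding lie_solvable_def by (rule exI[of _ 0]) simp
  moreover have "I \<subseteq> {\<zero>\<^bsub>L\<^esub>}"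
    if id: "lie_ideal class_ring ?M I" and sol: "lie_solvable class_ring (L\<lparr>carrier := I\<rparr>)" for I
  proof
    fix X assume X: "X \<in> I"
    have sub: "submodule class_ring I L"
      using id by (auto simp: lie_ideal_def intro: submodule_of_restricted_carrier levi_part_submodule)
    have br: "\<And>X Y. \<lbrakk>X \<in> ?S; Y \<in> I\<rbrakk> \<Longrightarrow> lie_bracket L X Y \<in> I"
      using id by (auto simp: lie_ideal_def)
    have IS: "I \<subseteq> ?S" using id by (auto simp: lie_ideal_def submodule_def)
    then obtain x where x: "x \<in> carrier_mat n m" "X = lower_left m n x" "block_traceless r x"
      using X unfolding levi_part_coords[OF rm rn] by blast
    have unit: "lower_left m n (mat_unit n m a b) \<in> ?S" if "a < r" "b < r" "a \<noteq> b" for a b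
      unfolding levi_part_coords[OF rm rn] using that rm rn
      by (auto simp: block_traceless_def intro!: imageI sum.neutral)
    have "\<exists>\<alpha>. block_scalar r \<alpha> x"
      by (rule solvable_ideal_block_scalar[OF sub])
        (use X x IS sol unit in \<open>auto intro!: br\<close>)
    then show "X \<in> {\<zero>\<^bsub>L\<^esub>}"
      using x block_scalar_traceless by (auto simp: zero_L)
  qed
  ultimately show ?thesis
    unfolding lie_semisimple_def is_lie_radical_def by simp
qed

lemma levi_radical_direct_sum:
  "internal_direct_sum L (levi_part m n r) (radical_part m n r)"
  unfolding internal_direct_sum_def
proof (intro conjI levi_inter_radical)
  let ?S = "levi_part m n r" and ?R = "radical_part m n r"
  have "X \<in> {u \<oplus>\<^bsub>L\<^esub> w | u w. u \<in> ?S \<and> w \<in> ?R}" if X: "X \<in> carrier L" for X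
  proof -
    obtain x where x: "X = lower_left m n x" "x \<in> carrier_mat n m"
      using X unfolding carrier_L by blast
    \<comment> \<open>The mean of the diagonal is the scalar whose removal makes the upper left
      block traceless. For \<open>r = 0\<close> the quotient is 0 by convention and the trace is an
      empty sum.\<close>
    define \<alpha> where "\<alpha> = (\<Sum>i<r. x $$ (i, i)) / of_nat r"
    define s where "s = mat n m (\<lambda>(i, j). if i < r \<and> j < r
      then x $$ (i, j) - (if i = j then \<alpha> else 0) else 0)"
    define w where "w = mat n m (\<lambda>(i, j). if i < r \<and> j < r
      then (if i = j then \<alpha> else 0) else x $$ (i, j))"
    have c: "s \<in> carrier_mat n m" "w \<in> carrier_mat n m" by (auto simp: s_def w_def)
    have "(\<Sum>i<r. s $$ (i, i)) = (\<Sum>i<r. x $$ (i, i)) - of_nat r * \<alpha>"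
      using rm rn by (simp add: s_def sum_subtractf)
    also have "\<dots> = 0" by (cases "r = 0") (auto simp: \<alpha>_def)
    finally have "block_traceless r s"
      by (auto simp: block_traceless_def s_def)
    moreover have "block_scalar r \<alpha> w"
      using rm rn by (auto simp: block_scalar_def w_def)
    ultimately have "lower_left m n s \<in> ?S" "lower_left m n w \<in> ?R"
      using c unfolding levi_part_coords[OF rm rn] radical_part_coords[OF rm rn] by blast+
    moreover have "s + w = x"
      using x by (intro eq_matI) (auto simp: s_def w_def)
    then have "X = lower_left m n s \<oplus>\<^bsub>L\<^esub> lower_left m n w"
      using c x by (simp add: add_L lower_left_add)
    ultimately show ?thesis by blast
  qed
  moreover have "u \<oplus>\<^bsub>L\<^esub> w \<in> carrier L" if "u \<in> ?S" "w \<in> ?R" for u w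
    using that submodule.subset[OF levi_part_submodule] submodule.subset[OF radical_part_submodule]
    by (auto simp: carrier_L add_L lower_left_add dest!: subsetD)
  ultimately show "carrier L = {u \<oplus>\<^bsub>L\<^esub> w | u w. u \<in> ?S \<and> w \<in> ?R}" by blast
qed

end

theorem corollary2:
  fixes m n r :: nat
    and B :: "'k::field_char_0 mat"
    and L :: "('k, 'k mat) lie_alg"
    and R S :: "'k mat set"
  assumes "0 < m" and "0 < n" and "r \<le> m" and "r \<le> n"
    and "B = normal_form m n r"
    and "L = gl_minus_derived m n B"
    and "R = radical_part m n r"
    and "S = levi_part m n r"
  shows "lie_solvable class_ring (L\<lparr>carrier := R\<rparr>) \<and>
    lie_semisimple class_ring (L\<lparr>carrier := S\<rparr>) \<and>
    is_lie_radical class_ring L R \<and>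
    levi_subalgebra class_ring L S \<and>
    levi_malcev_decomposition class_ring L S R"
proof -
  interpret normal_form_bracket m n r L
    using assms by unfold_locales auto
  have "levi_subalgebra class_ring L S"
    unfolding levi_subalgebra_def assms(8)
    using levi_part_subalgebra levi_part_semisimple radical_part_is_radical levi_radical_direct_sum
    by blast
  then show ?thesis
    using radical_part_solvable levi_part_semisimple radical_part_is_radical levi_radical_direct_sum
    unfolding levi_malcev_decomposition_def assms(7,8) by blast
qed

end
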